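(* Consider a coordination game with bonuses played on a weighted simple cycle. Let $\rho$ be any finite improvement path of this game. Then $\rho$ can be extended to a finite c-improvement path by adding at most one profitable coalition deviation step at its end; that is, either $\rho$ already ends in a strong equilibrium, or there is a profitable deviation $s'$ of some coalition from the last element of $\rho$ such that $s'$ is a strong equilibrium.
   Context: Coordination game: let $M$ be a finite set of colours and $G=(V,E)$ a finite directed graph without self-loops, with at least two nodes. Each edge $e\in E$ has a non-negative weight $w_e$. The set of neighbours of $i$ is $N_i=\{j\in V : (j\to i)\in E\}$. A colour assignment $C$ gives each node $i$ a non-empty set $C(i)\subseteq M$. A bonus function $\beta$ gives a natural number (possibly $0$) $\beta(i,c)$ for each node $i$ and colour $c$. The players of the coordination game are the nodes; the strategy set of player $i$ is $C(i)$; the payoff of $i$ in a joint strategy $s=(s_j)_{j\in V}$ is $p_i(s)=\sum_{j\in N_i,\ s_j=s_i} w_{j\to i}+\beta(i,s_i)$. "With bonuses" means $\beta$ is arbitrary. A simple cycle on $n$ nodes is the directed graph $1\to 2\to\cdots\to n\to 1$; it is weighted when its edges carry arbitrary non-negative weights. A coalition is a non-empty set of players. A joint strategy $s'$ is a deviation of the players in $K$ from $s$ if $K=\{i : s_i\neq s'_i\}$; it is profitable if $p_i(s')>p_i(s)$ for all $i\in K$. A strong equilibrium is a joint strategy from which no coalition has a profitable deviation. A c-improvement path is a maximal (i.e. non-extendable) sequence of joint strategies in which each element after the first is a profitable deviation of some coalition from the previous element. An improvement path is defined in the same way with all deviating coalitions (also in the definition of maximality) of size one; so a finite improvement path ends in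 a Nash equilibrium and a finite c-improvement path ends in a strong equilibrium. *)

theory Defs
  imports Complex_Main "HOL-Library.FuncSet" "HOL-Library.Sublist" "Graph_Theory.Pair_Digraph"
begin

record ('v, 'c) coordination_game =
  game_graph :: "'v pair_pre_digraph"
  weight :: "'v \<times> 'v \<Rightarrow> real"
  colours :: "'c set"
  assignment :: "'v \<Rightarrow> 'c set"
  bonus :: "'v \<Rightarrow> 'c \<Rightarrow> nat"

abbreviation players :: "('v, 'c) coordination_game \<Rightarrow> 'v set" where
  "players g \<equiv> pverts (game_graph g)"

text \<open>\<open>pair_digraph\<close> is the library's locale of finite directed graphs without self-loops
  whose arcs are pairs of vertices.\<close>

definition is_coordination_game :: "('v, 'c) coordination_game \<Rightarrow> bool" where
  "is_coordination_game g \<longleftrightarrow>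
     pair_digraph (game_graph g) \<and> 2 \<le> card (players g) \<and>
     (\<forall>e \<in> parcs (game_graph g). 0 \<le> weight g e) \<and>
     finite (colours g) \<and>
     (\<forall>i \<in> players g. assignment g i \<noteq> {} \<and> assignment g i \<subseteq> colours g)"

definition is_simple_cycle :: "'v pair_pre_digraph \<Rightarrow> bool" where
  "is_simple_cycle G \<longleftrightarrow>
     (\<exists>n v. bij_betw v {..<n} (pverts G) \<and>
            parcs G = (\<lambda>i. (v i, v (Suc i mod n))) ` {..<n})"

definition neighbours :: "('v, 'c) coordination_game \<Rightarrow> 'v \<Rightarrow> 'v set" where
  "neighbours g i = {j \<in> players g. (j, i) \<in> parcs (game_graph g)}"

text \<open>Joint strategies are extensional functions on the players, so that they are equal
  exactly if they agree on all players.\<close>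

definition joint_strategies :: "('v, 'c) coordination_game \<Rightarrow> ('v \<Rightarrow> 'c) set" where
  "joint_strategies g = (\<Pi>\<^sub>E i\<in>players g. assignment g i)"

definition payoff :: "('v, 'c) coordination_game \<Rightarrow> 'v \<Rightarrow> ('v \<Rightarrow> 'c) \<Rightarrow> real" where
  "payoff g i s =
     (\<Sum>j\<in>{j \<in> neighbours g i. s j = s i}. weight g (j, i)) + real (bonus g i (s i))"

definition coalition :: "('v, 'c) coordination_game \<Rightarrow> 'v set \<Rightarrow> bool" where
  "coalition g K \<longleftrightarrow> K \<noteq> {} \<and> K \<subseteq> players g"

definition deviation ::
  "('v, 'c) coordination_game \<Rightarrow> 'v set \<Rightarrow> ('v \<Rightarrow> 'c) \<Rightarrow> ('v \<Rightarrow> 'c) \<Rightarrow> bool" where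
  "deviation g K s s' \<longleftrightarrow>
     s \<in> joint_strategies g \<and> s' \<in> joint_strategies g \<and> K = {i \<in> players g. s i \<noteq> s' i}"

definition profitable_deviation ::
  "('v, 'c) coordination_game \<Rightarrow> 'v set \<Rightarrow> ('v \<Rightarrow> 'c) \<Rightarrow> ('v \<Rightarrow> 'c) \<Rightarrow> bool" where
  "profitable_deviation g K s s' \<longleftrightarrow>
     coalition g K \<and> deviation g K s s' \<and> (\<forall>i\<in>K. payoff g i s' > payoff g i s)"

definition strong_equilibrium :: "('v, 'c) coordination_game \<Rightarrow> ('v \<Rightarrow> 'c) \<Rightarrow> bool" where
  "strong_equilibrium g s \<longleftrightarrow>
     s \<in> joint_strategies g \<and> (\<nexists>K s'. profitable_deviation g K s s')"

text \<open>The predicate \<open>P\<close> says which coalitions may deviate.\<close>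

definition improvement_sequence ::
  "('v set \<Rightarrow> bool) \<Rightarrow> ('v, 'c) coordination_game \<Rightarrow> ('v \<Rightarrow> 'c) list \<Rightarrow> bool" where
  "improvement_sequence P g \<rho> \<longleftrightarrow>
     \<rho> \<noteq> [] \<and> set \<rho> \<subseteq> joint_strategies g \<and>
     successively (\<lambda>s s'. \<exists>K. P K \<and> profitable_deviation g K s s') \<rho>"

text \<open>Lists represent exactly the finite paths. Comparing with finite extensions only loses
  nothing, since an infinite extension of a finite sequence has finite prefixes that are
  also proper extensions.\<close>

definition maximal_improvement_sequence ::
  "('v set \<Rightarrow> bool) \<Rightarrow> ('v, 'c) coordination_game \<Rightarrow> ('v \<Rightarrow> 'c) list \<Rightarrow> bool" where
  "maximal_improvement_sequence P g \<rho> \<longleftrightarrow>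
     improvement_sequence P g \<rho> \<and> (\<nexists>\<sigma>. strict_prefix \<rho> \<sigma> \<and> improvement_sequence P g \<sigma>)"

definition finite_improvement_path ::
  "('v, 'c) coordination_game \<Rightarrow> ('v \<Rightarrow> 'c) list \<Rightarrow> bool" where
  "finite_improvement_path = maximal_improvement_sequence (\<lambda>K. card K = 1)"

definition finite_c_improvement_path ::
  "('v, 'c) coordination_game \<Rightarrow> ('v \<Rightarrow> 'c) list \<Rightarrow> bool" where
  "finite_c_improvement_path = maximal_improvement_sequence (\<lambda>K. True)"

end

(* On a cycle every player has a single predecessor. Let s be a Nash equilibrium with a profitable
   deviation s' of a coalition K. A member of K whose predecessor is outside K, or whose colour in s'
   differs from that of its predecessor, would gain already by deviating alone; hence K contains all
   players, s' is monochromatic, and everybody is better off. Conversely, any monochromatic t in which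
   everybody is better off than in s is again a Nash equilibrium: a player who leaves t alone gets
   nothing but its bonus, which it could also have obtained by deviating alone from s. So among these
   finitely many t, one that maximises the payoff of a fixed player is a strong equilibrium. *)

theory Submission
  imports Defs
begin

section \<open>Maximal improvement sequences\<close>

lemma improvement_sequence_append:
  assumes "\<rho> \<noteq> []"
  shows "improvement_sequence P g (\<rho> @ s' # \<sigma>) \<longleftrightarrow>
    improvement_sequence P g \<rho> \<and> (\<exists>K. P K \<and> profitable_deviation g K (last \<rho>) s') \<and>
    improvement_sequence P g (s' # \<sigma>)"
  using assms by (auto simp: improvement_sequence_def successively_append_iff)

lemma improvement_sequence_single:
  "improvement_sequence P g [s] \<longleftrightarrow> s \<in> joint_strategies g"
  by (simp add: improvement_sequence_def)

lemma profitable_deviation_joint: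
  assumes "profitable_deviation g K s s'"
  shows "s \<in> joint_strategies g" "s' \<in> joint_strategies g"
  using assms by (auto simp: profitable_deviation_def deviation_def)

text \<open>The first element that a proper extension adds is itself an admissible deviation from
  \<open>last \<rho>\<close>, and any such deviation gives an extension by one element. So
  maximality concerns only the last joint strategy.\<close>

lemma maximal_improvement_sequence_iff:
  "maximal_improvement_sequence P g \<rho> \<longleftrightarrow>
    improvement_sequence P g \<rho> \<and> (\<nexists>K s'. P K \<and> profitable_deviation g K (last \<rho>) s')"
proof (cases "improvement_sequence P g \<rho>")
  case True
  then have ne: "\<rho> \<noteq> []"
    by (simp add: improvement_sequence_def)
  have "(\<exists>\<sigma>. strict_prefix \<rho> \<sigma> \<and> improvement_sequence P g \<sigma>) \<longleftrightarrow>
      (\<exists>s' \<tau>. improvement_sequence P g (\<rho> @ s' # \<tau>))"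
    by (metis strict_prefixE' strict_prefixI')
  also have "\<dots> \<longleftrightarrow> (\<exists>K s'. P K \<and> profitable_deviation g K (last \<rho>) s')"
    unfolding improvement_sequence_append[OF ne]
    using True improvement_sequence_single profitable_deviation_joint(2) by metis
  finally show ?thesis
    by (simp add: maximal_improvement_sequence_def)
qed (simp add: maximal_improvement_sequence_def)

text \<open>This lets a path of single-player deviations be read as a path of coalition
  deviations.\<close>

lemma improvement_sequence_mono:
  assumes "improvement_sequence P g \<rho>" and "\<And>K. P K \<Longrightarrow> Q K"
  shows "improvement_sequence Q g \<rho>"
  using assms successively_mono[of "\<lambda>s s'. \<exists>K. P K \<and> profitable_deviation g K s s'" \<rho>
      "\<lambda>s s'. \<exists>K. Q K \<and> profitable_deviation g K s s'"]
  unfolding improvement_sequence_def by blast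

lemma finite_c_improvement_path_iff:
  "finite_c_improvement_path g \<rho> \<longleftrightarrow>
    improvement_sequence (\<lambda>K. True) g \<rho> \<and> strong_equilibrium g (last \<rho>)"
proof -
  have "improvement_sequence (\<lambda>K. True) g \<rho> \<Longrightarrow> last \<rho> \<in> joint_strategies g"
    by (auto simp: improvement_sequence_def)
  then show ?thesis
    unfolding finite_c_improvement_path_def maximal_improvement_sequence_iff strong_equilibrium_def
    by auto
qed

section \<open>Nash equilibria\<close>

text \<open>Function updates replace one-element coalitions, so that payoffs can be compared
  directly; the case \<open>d = s i\<close> is harmless.\<close>

definition nash_equilibrium :: "('v, 'c) coordination_game \<Rightarrow> ('v \<Rightarrow> 'c) \<Rightarrow> bool" where
  "nash_equilibrium g s \<longleftrightarrow> s \<in> joint_strategies g \<and>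
    (\<forall>i\<in>players g. \<forall>d\<in>assignment g i. payoff g i (s(i := d)) \<le> payoff g i s)"

lemma nash_equilibrium_iff:
  "nash_equilibrium g s \<longleftrightarrow>
    s \<in> joint_strategies g \<and> (\<nexists>K s'. card K = 1 \<and> profitable_deviation g K s s')"
proof (cases "s \<in> joint_strategies g")
  case s: True
  have "payoff g i (s(i := d)) \<le> payoff g i s"
    if no: "\<nexists>K s'. card K = 1 \<and> profitable_deviation g K s s'"
      and i: "i \<in> players g" and d: "d \<in> assignment g i" for i d
  proof (rule ccontr)
    assume less: "\<not> ?thesis"
    then have "d \<noteq> s i" by auto
    moreover have "s(i := d) \<in> joint_strategies g"
      using s i d by (auto simp: joint_strategies_def PiE_def extensional_def)
    ultimately have "profitable_deviation g {i} s (s(i := d))"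
      using s i less by (auto simp: profitable_deviation_def coalition_def deviation_def)
    then show False
      using no by (metis is_singletonI is_singleton_altdef)
  qed
  moreover have "\<nexists>K s'. card K = 1 \<and> profitable_deviation g K s s'"
    if nash: "\<forall>i\<in>players g. \<forall>d\<in>assignment g i. payoff g i (s(i := d)) \<le> payoff g i s"
  proof
    assume "\<exists>K s'. card K = 1 \<and> profitable_deviation g K s s'"
    then obtain i s' where dev: "profitable_deviation g {i} s s'"
      by (auto simp: card_1_singleton_iff)
    then have i: "i \<in> players g" and s': "s' \<in> joint_strategies g"
      and eq: "{i} = {j \<in> players g. s j \<noteq> s' j}"
      and less: "payoff g i s < payoff g i s'"
      by (auto simp: profitable_deviation_def coalition_def deviation_def)
    \<comment> \<open>Both strategies are extensional, so they also agree outside the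
      players.\<close>
    have "s' = s(i := s' i)"
    proof (rule ext)
      fix j
      have "s' j = s j" if "j \<noteq> i"
        using that eq s s' PiE_arb unfolding joint_strategies_def by (cases "j \<in> players g") fastforce+
      then show "s' j = (s(i := s' i)) j" by simp
    qed
    moreover have "s' i \<in> assignment g i"
      using s' i by (auto simp: joint_strategies_def)
    ultimately show False
      using nash i less by (metis not_less)
  qed
  ultimately show ?thesis
    using s unfolding nash_equilibrium_def by blast
qed (simp add: nash_equilibrium_def)

lemma finite_improvement_path_iff:
  "finite_improvement_path g \<rho> \<longleftrightarrow>
    improvement_sequence (\<lambda>K. card K = 1) g \<rho> \<and> nash_equilibrium g (last \<rho>)"
proof -
  have "improvement_sequence (\<lambda>K. card K = 1) g \<rho> \<Longrightarrow> last \<rho> \<in> joint_strategies g"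
    by (auto simp: improvement_sequence_def)
  then show ?thesis
    unfolding finite_improvement_path_def maximal_improvement_sequence_iff nash_equilibrium_iff
    by auto
qed

lemma finite_joint_strategies:
  assumes "is_coordination_game g"
  shows "finite (joint_strategies g)"
proof -
  have "finite (players g)"
    using assms
    by (intro pair_fin_digraph.pair_finite_verts pair_digraph.axioms(1))
      (simp add: is_coordination_game_def)
  then show ?thesis
    using assms unfolding joint_strategies_def is_coordination_game_def
    by (intro finite_PiE) (auto intro: finite_subset)
qed

section \<open>Games on a cycle\<close>

text \<open>These are the properties of a cycle from which the game-theoretic argument proceeds.
  \<open>pred_closed\<close> is connectedness: walking backwards from one player reaches all others,
  which excludes disjoint unions of cycles.\<close>

locale cycle_game =
  fixes g :: "('v, 'c) coordination_game" and pred :: "'v \<Rightarrow> 'v"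
  assumes game: "is_coordination_game g"
    and pred_player: "i \<in> players g \<Longrightarrow> pred i \<in> players g"
    and pred_neq: "i \<in> players g \<Longrightarrow> pred i \<noteq> i"
    and neighbours_eq: "i \<in> players g \<Longrightarrow> neighbours g i = {pred i}"
    and pred_closed:
      "\<lbrakk>K \<subseteq> players g; K \<noteq> {}; \<And>i. i \<in> K \<Longrightarrow> pred i \<in> K\<rbrakk> \<Longrightarrow> K = players g"
begin

lemma payoff_eq:
  assumes "i \<in> players g"
  shows "payoff g i s =
    (if s (pred i) = s i then weight g (pred i, i) else 0) + real (bonus g i (s i))"
proof -
  have "{j \<in> neighbours g i. s j = s i} = (if s (pred i) = s i then {pred i} else {})"
    using assms by (auto simp: neighbours_eq)
  then show ?thesis by (simp add: payoff_def)
qed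

lemma weight_nonneg:
  assumes "i \<in> players g"
  shows "0 \<le> weight g (pred i, i)"
proof -
  have "(pred i, i) \<in> parcs (game_graph g)"
    using neighbours_eq[OF assms] by (auto simp: neighbours_def)
  then show ?thesis
    using game by (auto simp: is_coordination_game_def)
qed

lemma bonus_le_payoff:
  assumes "i \<in> players g"
  shows "real (bonus g i (s i)) \<le> payoff g i s"
  using weight_nonneg[OF assms] by (simp add: payoff_eq[OF assms])

text \<open>Agreement with the predecessor is a local condition, but by \<open>pred_closed\<close>
  it makes \<open>t\<close> constant on the players.\<close>

definition better_mono :: "('v \<Rightarrow> 'c) \<Rightarrow> ('v \<Rightarrow> 'c) set" where
  "better_mono s = {t \<in> joint_strategies g.
     \<forall>i\<in>players g. t (pred i) = t i \<and> payoff g i s < payoff g i t}"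

lemma profitable_deviation_in_better_mono:
  assumes nash: "nash_equilibrium g s" and dev: "profitable_deviation g K s s'"
  shows "s' \<in> better_mono s"
proof -
  have s': "s' \<in> joint_strategies g"
    using dev by (rule profitable_deviation_joint)
  have K: "K \<noteq> {}" "K = {i \<in> players g. s i \<noteq> s' i}"
    and gain: "\<And>i. i \<in> K \<Longrightarrow> payoff g i s < payoff g i s'"
    using dev by (auto simp: profitable_deviation_def coalition_def deviation_def)
  \<comment> \<open>Taking the new colour alone cannot pay in a Nash equilibrium, so it yields less
    than the joint move.\<close>
  have alone: "payoff g i (s(i := s' i)) < payoff g i s'" if "i \<in> K" for i
  proof -
    have "payoff g i (s(i := s' i)) \<le> payoff g i s"
      using nash s' that K by (auto simp: nash_equilibrium_def joint_strategies_def)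
    then show ?thesis
      using gain[OF that] by simp
  qed
  have mono: "s' (pred i) = s' i" if "i \<in> K" for i
  proof (rule ccontr)
    assume "s' (pred i) \<noteq> s' i"
    \<comment> \<open>Without agreement the payoff in \<open>s'\<close> is the bare bonus, which
      moving alone secures as well.\<close>
    then have "payoff g i s' \<le> payoff g i (s(i := s' i))"
      using that K bonus_le_payoff[of i "s(i := s' i)"] by (auto simp: payoff_eq)
    then show False
      using alone[OF that] by simp
  qed
  have "pred i \<in> K" if "i \<in> K" for i
  proof (rule ccontr)
    assume "pred i \<notin> K"
    then have "s (pred i) = s' (pred i)"
      using that K pred_player by auto
    \<comment> \<open>The payoff depends only on the colours of \<open>i\<close> and
      \<open>pred i\<close>, and \<open>pred i \<noteq> i\<close> keeps the update away from the
      predecessor.\<close>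
    then have "payoff g i s' = payoff g i (s(i := s' i))"
      using that K pred_neq by (auto simp: payoff_eq)
    then show False
      using alone[OF that] by simp
  qed
  then have "K = players g"
    using K by (intro pred_closed) auto
  then show ?thesis
    using s' mono gain by (auto simp: better_mono_def)
qed

lemma nash_better_mono:
  assumes nash: "nash_equilibrium g s" and t: "t \<in> better_mono s"
  shows "nash_equilibrium g t"
proof -
  have "payoff g i (t(i := d)) \<le> payoff g i t"
    if i: "i \<in> players g" and d: "d \<in> assignment g i" for i d
  proof (cases "d = t i")
    case False
    have "t (pred i) = t i" and gain: "payoff g i s < payoff g i t"
      using t i by (auto simp: better_mono_def)
    then have "payoff g i (t(i := d)) = real (bonus g i d)"
      using False i pred_neq by (auto simp: payoff_eq)
    also have "\<dots> \<le> payoff g i (s(i := d))"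
      using bonus_le_payoff[OF i, of "s(i := d)"] by simp
    also have "\<dots> \<le> payoff g i s"
      using nash i d by (auto simp: nash_equilibrium_def)
    finally show ?thesis
      using gain by simp
  qed simp
  then show ?thesis
    using t by (auto simp: nash_equilibrium_def better_mono_def)
qed

text \<open>The coalition consists of the players whose colour changes. It is non-empty because
  equal strategies would give equal payoffs.\<close>

lemma better_mono_profitable:
  assumes s: "s \<in> joint_strategies g" and t: "t \<in> better_mono s"
  shows "\<exists>K. profitable_deviation g K s t"
proof -
  have gain: "\<forall>i\<in>players g. payoff g i s < payoff g i t" and tj: "t \<in> joint_strategies g"
    using t by (auto simp: better_mono_def)
  have "players g \<noteq> {}"
    using game by (auto simp: is_coordination_game_def)
  then have "s \<noteq> t"
    using gain by auto
  then have "{i \<in> players g. s i \<noteq> t i} \<noteq> {}"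
    using s tj PiE_ext unfolding joint_strategies_def by blast
  then have "profitable_deviation g {i \<in> players g. s i \<noteq> t i} s t"
    using s tj gain by (auto simp: profitable_deviation_def coalition_def deviation_def)
  then show ?thesis ..
qed

lemma nash_strong_or_deviates_to_strong:
  assumes nash: "nash_equilibrium g s"
  shows "strong_equilibrium g s \<or> (\<exists>K t. profitable_deviation g K s t \<and> strong_equilibrium g t)"
proof (cases "strong_equilibrium g s")
  case False
  have s: "s \<in> joint_strategies g"
    using nash by (simp add: nash_equilibrium_def)
  have "better_mono s \<noteq> {}"
    using False s profitable_deviation_in_better_mono[OF nash]
    by (auto simp: strong_equilibrium_def)
  moreover have "finite (better_mono s)"
    using finite_joint_strategies[OF game] by (auto simp: better_mono_def)
  \<comment> \<open>Any player can serve as the yardstick, since passing from \<open>t\<close> to an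
    element of \<open>better_mono t\<close> raises every payoff strictly.\<close>
  moreover obtain i where i: "i \<in> players g"
    using game by (fastforce simp: is_coordination_game_def)
  ultimately obtain t where t: "t \<in> better_mono s"
    and max: "\<And>t'. t' \<in> better_mono s \<Longrightarrow> payoff g i t' \<le> payoff g i t"
    by (metis obtains_MAX Max_ge finite_imageI imageI)
  have "strong_equilibrium g t"
    unfolding strong_equilibrium_def
  proof (intro conjI notI)
    show "t \<in> joint_strategies g"
      using t by (simp add: better_mono_def)
    assume "\<exists>K t'. profitable_deviation g K t t'"
    \<comment> \<open>As \<open>t\<close> is again Nash, its profitable deviations lie in
      \<open>better_mono t\<close>, hence in \<open>better_mono s\<close> by transitivity, against
      the maximality of \<open>t\<close>.\<close>
    then obtain t' where "t' \<in> better_mono t"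
      using profitable_deviation_in_better_mono nash_better_mono[OF nash t] by blast
    then have "t' \<in> better_mono s" "payoff g i t < payoff g i t'"
      using t i by (fastforce simp: better_mono_def)+
    then show False
      using max by fastforce
  qed
  then show ?thesis
    using better_mono_profitable[OF s t] by blast
qed simp

end

section \<open>The predecessor map of a simple cycle\<close>

lemma cycle_game_exists:
  assumes game: "is_coordination_game g" and cycle: "is_simple_cycle (game_graph g)"
  obtains pred where "cycle_game g pred"
proof -
  obtain n v where bij: "bij_betw v {..<n} (players g)"
    and arcs: "parcs (game_graph g) = (\<lambda>k. (v k, v (Suc k mod n))) ` {..<n}"
    using cycle unfolding is_simple_cycle_def by blast
  have n: "2 \<le> n"
    using game bij_betw_same_card[OF bij] by (simp add: is_coordination_game_def)
  have inj: "inj_on v {..<n}" and players: "players g = v ` {..<n}"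
    using bij by (auto simp: bij_betw_def)
  \<comment> \<open>\<open>pr\<close> inverts \<open>k \<mapsto> Suc k mod n\<close> on the indices
    below \<open>n\<close>; the index 0 wraps round to \<open>n - 1\<close>.\<close>
  define pr where "pr k = (if k = 0 then n - 1 else k - 1)" for k
  define pred where "pred i = v (pr (the_inv_into {..<n} v i))" for i
  have pred_v: "pred (v k) = v (pr k)" if "k < n" for k
    using that inj by (simp add: pred_def the_inv_into_f_f)
  have pr_less: "pr k < n" if "k < n" for k
    using that by (auto simp: pr_def)
  have pr_Suc: "Suc l mod n = k \<longleftrightarrow> l = pr k" if "k < n" "l < n" for k l
    using that n by (cases "Suc l = n") (auto simp: pr_def)
  have "cycle_game g pred"
  proof
    fix i assume "i \<in> players g"
    then obtain k where k: "k < n" "i = v k"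
      using players by auto
    show "pred i \<in> players g"
      using k pr_less pred_v players by auto
    \<comment> \<open>Here \<open>2 \<le> n\<close> matters: for \<open>n = 1\<close> the index 0
      would be its own predecessor.\<close>
    have "pr k \<noteq> k"
      using k n by (auto simp: pr_def)
    then show "pred i \<noteq> i"
      using k pr_less pred_v inj by (auto dest: inj_onD)
    have "(v l, v k) \<in> parcs (game_graph g) \<longleftrightarrow> l = pr k" if "l < n" for l
    proof -
      have "(v l, v k) \<in> parcs (game_graph g) \<longleftrightarrow> Suc l mod n = k"
      proof
        assume "(v l, v k) \<in> parcs (game_graph g)"
        then obtain m where m: "m < n" "v l = v m" "v k = v (Suc m mod n)"
          using arcs by auto
        then have "l = m"
          using inj_onD[OF inj m(2)] that by simp
        moreover have "k = Suc m mod n"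
          using inj_onD[OF inj m(3)] k n by simp
        ultimately show "Suc l mod n = k" by simp
      qed (use arcs that in auto)
      then show ?thesis
        using pr_Suc[OF k(1) that] by simp
    qed
    then show "neighbours g i = {pred i}"
      using k pr_less pred_v players by (auto simp: neighbours_def)
  next
    fix K assume K: "K \<subseteq> players g" "K \<noteq> {}" and closed: "\<And>i. i \<in> K \<Longrightarrow> pred i \<in> K"
    have pr_in: "v (pr k) \<in> K" if "v k \<in> K" "k < n" for k
      using closed[OF that(1)] pred_v[OF that(2)] by simp
    have down: "v l \<in> K" if "l \<le> k" "k < n" "v k \<in> K" for k l
      using that
    proof (induction rule: inc_induct)
      case (step m)
      then show ?case
        using pr_in[of "Suc m"] by (simp add: pr_def)
    qed
    obtain i where i: "i \<in> K"
      using K(2) by auto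
    with K(1) players have "i \<in> v ` {..<n}"
      by auto
    then obtain k where "k < n" "v k \<in> K"
      using i by auto
    \<comment> \<open>Descend to index 0, wrap round to \<open>n - 1\<close>, and descend again to
      reach every index.\<close>
    then have "v 0 \<in> K"
      using down[of 0 k] by simp
    then have "v (n - 1) \<in> K"
      using pr_in[of 0] n by (simp add: pr_def)
    then have "v l \<in> K" if "l < n" for l
      using down[of l "n - 1"] that by simp
    then show "K = players g"
      using K players by auto
  qed (rule game)
  then show thesis by (rule that)
qed

section \<open>Appending the coalition step to the path\<close>

theorem theorem7:
  fixes g :: "('v, 'c) coordination_game" and \<rho> :: "('v \<Rightarrow> 'c) list"
  assumes "is_coordination_game g"
    and "is_simple_cycle (game_graph g)"
    and "finite_improvement_path g \<rho>"
  shows "(\<exists>\<sigma>. length \<sigma> \<le> 1 \<and> finite_c_improvement_path g (\<rho> @ \<sigma>)) \<and>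
         (strong_equilibrium g (last \<rho>) \<or>
          (\<exists>K s'. profitable_deviation g K (last \<rho>) s' \<and> strong_equilibrium g s'))"
proof
  obtain pred where "cycle_game g pred"
    using cycle_game_exists assms(1,2) .
  moreover have path: "improvement_sequence (\<lambda>K. card K = 1) g \<rho>"
    and "nash_equilibrium g (last \<rho>)"
    using assms by (auto simp: finite_improvement_path_iff)
  ultimately show strong: "strong_equilibrium g (last \<rho>) \<or>
      (\<exists>K s'. profitable_deviation g K (last \<rho>) s' \<and> strong_equilibrium g s')"
    by (intro cycle_game.nash_strong_or_deviates_to_strong)
  have c_path: "improvement_sequence (\<lambda>K. True) g \<rho>"
    using path by (rule improvement_sequence_mono) simp
  then have ne: "\<rho> \<noteq> []"
    by (simp add: improvement_sequence_def)
  \<comment> \<open>The extension \<open>\<sigma>\<close> is empty if the path already ends in a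
    strong equilibrium, and otherwise consists of the strong equilibrium that the coalition
    reaches.\<close>
  from strong show "\<exists>\<sigma>. length \<sigma> \<le> 1 \<and> finite_c_improvement_path g (\<rho> @ \<sigma>)"
  proof (elim disjE exE conjE)
    assume "strong_equilibrium g (last \<rho>)"
    then have "finite_c_improvement_path g (\<rho> @ [])"
      using c_path by (simp add: finite_c_improvement_path_iff)
    then show ?thesis
      by (intro exI[of _ "[]"]) simp
  next
    fix K s' assume dev: "profitable_deviation g K (last \<rho>) s'" and "strong_equilibrium g s'"
    then have "finite_c_improvement_path g (\<rho> @ [s'])"
      using c_path ne profitable_deviation_joint(2)[OF dev]
      by (auto simp: finite_c_improvement_path_iff improvement_sequence_append
          improvement_sequence_single)
    then show ?thesis
      by (intro exI[of _ "[s']"]) simp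
  qed
qed

end
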